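(* Let $p,q,r,s\in\mathbb{N}$ be positive integers such that $\left(\frac pq,\frac rs\right)\in\mathcal D$, and put $\boldsymbol{\alpha}=\left(\frac pq,\frac rs\right)$. Then the $\boldsymbol{\alpha}$-Hurwitz algorithm satisfies the finite range condition. Equivalently, the map $T_{\boldsymbol{\alpha}}$ admits a finite partition of $U_{\boldsymbol{\alpha}}$.
   Context: Let $B_\varepsilon(a,b)\subseteq\mathbb{R}^2$ be the open Euclidean ball with center $(a,b)$ and radius $\varepsilon$, and let $\overline{B}$ denote the closure of a set $B$. Define $$\mathcal D=B_1(0,0)\cap\overline{B_1(1,0)}\cap\overline{B_1(0,1)}\cap\overline{B_1(1,1)}.$$ For $\boldsymbol{\alpha}=(\alpha_1,\alpha_2)\in\mathbb{R}^2$ set $$U_{\boldsymbol{\alpha}}=\{z\in\mathbb{C}: \alpha_1-1\le \Re z<\alpha_1,\ \alpha_2-1\le \Im z<\alpha_2\}.$$ $\mathbb{Z}[i]$ denotes the Gaussian integers. For $z\in\mathbb{C}$ let $\lfloor z\rfloor_{\boldsymbol{\alpha}}$ be the unique $w\in\mathbb{Z}[i]$ with $z-w\in U_{\boldsymbol{\alpha}}$. The $\boldsymbol{\alpha}$-Hurwitz map is $$T_{\boldsymbol{\alpha}}:U_{\boldsymbol{\alpha}}\setminus\{0\}\to U_{\boldsymbol{\alpha}},\qquad z\mapsto \frac1z-\left\lfloor\frac1z\right\rfloor_{\boldsymbol{\alpha}},$$ and the associated algorithm assigning to $z$ the digits $a_k=\lfloor 1/T_{\boldsymbol{\alpha}}^{k-1}(z)\rfloor_{\boldsymbol{\alpha}}$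 (as long as the iterates do not vanish) is called the $\boldsymbol{\alpha}$-Hurwitz algorithm. Cylinder sets: for $b\in\mathbb{Z}[i]$ let $\Delta_{\boldsymbol{\alpha}}(b)=\{z\in U_{\boldsymbol{\alpha}}\setminus\{0\}:\lfloor 1/z\rfloor_{\boldsymbol{\alpha}}=b\}$, and let $T_{\boldsymbol{\alpha},b}$ be the restriction of $T_{\boldsymbol{\alpha}}$ to $\Delta_{\boldsymbol{\alpha}}(b)$. For $n\ge2$ and $b_1,\dots,b_n\in\mathbb{Z}[i]$ let $$\Delta_{\boldsymbol{\alpha}}(b_1,\dots,b_n)=T_{\boldsymbol{\alpha},b_1}^{-1}(\Delta_{\boldsymbol{\alpha}}(b_2,\dots,b_n))\cap U_{\boldsymbol{\alpha}}.$$ Finite range condition: the $\boldsymbol{\alpha}$-Hurwitz algorithm satisfies the finite range condition if the collection $$\{T_{\boldsymbol{\alpha}}^n(\Delta_{\boldsymbol{\alpha}}(b_1,\dots,b_n)) : b_1,\dots,b_n\in\mathbb{Z}[i],\ n\ge2\}$$ contains only finitely many sets up to Lebesgue null sets (i.e. finitely many classes when sets differing by a Lebesgue null set are identified). Finite partition: a collection $\mathcal P$ of Borel measurable subsets of $U_{\boldsymbol{\alpha}}$ is a partition of $U_{\boldsymbol{\alpha}}$ if its members are pairwise disjoint and $U_{\boldsymbol{\alpha}}=\bigcup_{P\in\mathcal P}P$, up to sets of zero Lebesgue measure. $T_{\boldsymbol{\alpha}}$ admits a finite partition of $U_{\boldsymbol{\alpha}}$ if there is a finite partition $\mathcal P$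 of $U_{\boldsymbol{\alpha}}$ such that for every $b\in\mathbb{Z}[i]$ with $\Delta_{\boldsymbol{\alpha}}(b)\ne\emptyset$ and every $P\in\mathcal P$, the set $T_{\boldsymbol{\alpha}}(\Delta_{\boldsymbol{\alpha}}(b)\cap P)$ is a union of elements of $\mathcal P$ up to sets of zero Lebesgue measure. *)

theory Defs
  imports "HOL-Analysis.Analysis"
begin

text \<open>The product metric on \<^typ>\<open>real \<times> real\<close> is the Euclidean one, so \<^const>\<open>ball\<close> is the
  Euclidean ball of the plane.\<close>

definition admissible_region :: "(real \<times> real) set" where
  "admissible_region =
     ball (0, 0) 1 \<inter> closure (ball (1, 0) 1) \<inter> closure (ball (0, 1) 1) \<inter> closure (ball (1, 1) 1)"

definition gaussian_integers :: "complex set" where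
  "gaussian_integers = {w. Re w \<in> \<int> \<and> Im w \<in> \<int>}"

definition fund_domain :: "real \<times> real \<Rightarrow> complex set" where
  "fund_domain \<alpha> =
     {z. fst \<alpha> - 1 \<le> Re z \<and> Re z < fst \<alpha> \<and> snd \<alpha> - 1 \<le> Im z \<and> Im z < snd \<alpha>}"

definition hurwitz_floor :: "real \<times> real \<Rightarrow> complex \<Rightarrow> complex" where
  "hurwitz_floor \<alpha> z = (THE w. w \<in> gaussian_integers \<and> z - w \<in> fund_domain \<alpha>)"

lemma hurwitz_floor_ex1: "\<exists>!w. w \<in> gaussian_integers \<and> z - w \<in> fund_domain \<alpha>"
proof (rule ex_ex1I)
  let ?w = "Complex (of_int (\<lfloor>Re z - fst \<alpha>\<rfloor> + 1)) (of_int (\<lfloor>Im z - snd \<alpha>\<rfloor> + 1))"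
  have "?w \<in> gaussian_integers"
    unfolding gaussian_integers_def by (simp del: of_int_add)
  moreover have "z - ?w \<in> fund_domain \<alpha>"
    unfolding fund_domain_def by (simp, linarith)
  ultimately show "\<exists>w. w \<in> gaussian_integers \<and> z - w \<in> fund_domain \<alpha>" by blast
next
  fix w v
  assume w: "w \<in> gaussian_integers \<and> z - w \<in> fund_domain \<alpha>"
    and v: "v \<in> gaussian_integers \<and> z - v \<in> fund_domain \<alpha>"
  obtain a b c d :: int where "Re w = a" "Im w = b" "Re v = c" "Im v = d"
    using w v unfolding gaussian_integers_def by (auto elim!: Ints_cases)
  moreover from this have "a = c" "b = d"
    using w v unfolding fund_domain_def by auto
  ultimately show "w = v" by (simp add: complex_eq_iff)
qed

text \<open>As a total function this takes a junk value at \<open>0\<close>. It is only ever applied to points of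
  cylinders, which exclude \<open>0\<close>, and its \<open>n\<close>-th iterate only to points of cylinders of length \<open>n\<close>,
  where no earlier iterate vanishes.\<close>

definition hurwitz_map :: "real \<times> real \<Rightarrow> complex \<Rightarrow> complex" where
  "hurwitz_map \<alpha> z = 1 / z - hurwitz_floor \<alpha> (1 / z)"

definition cylinder1 :: "real \<times> real \<Rightarrow> complex \<Rightarrow> complex set" where
  "cylinder1 \<alpha> b = {z \<in> fund_domain \<alpha> - {0}. hurwitz_floor \<alpha> (1 / z) = b}"

text \<open>The value on the empty list is a convention and is not used.\<close>

fun cylinder :: "real \<times> real \<Rightarrow> complex list \<Rightarrow> complex set" where
  "cylinder \<alpha> [] = fund_domain \<alpha>"
| "cylinder \<alpha> [b] = cylinder1 \<alpha> b"
| "cylinder \<alpha> (b # c # bs) = {z \<in> cylinder1 \<alpha> b. hurwitz_map \<alpha> z \<in> cylinder \<alpha> (c # bs)}"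

definition ae_equal :: "complex set \<Rightarrow> complex set \<Rightarrow> bool" where
  "ae_equal A B \<longleftrightarrow> (A - B) \<union> (B - A) \<in> null_sets lebesgue"

definition range_sets :: "real \<times> real \<Rightarrow> complex set set" where
  "range_sets \<alpha> =
     {(hurwitz_map \<alpha> ^^ length bs) ` cylinder \<alpha> bs | bs.
        set bs \<subseteq> gaussian_integers \<and> 2 \<le> length bs}"

definition finite_range_condition :: "real \<times> real \<Rightarrow> bool" where
  "finite_range_condition \<alpha> \<longleftrightarrow> finite (range_sets \<alpha> // {(A, B). ae_equal A B})"

definition is_partition :: "real \<times> real \<Rightarrow> complex set set \<Rightarrow> bool" where
  "is_partition \<alpha> \<P> \<longleftrightarrow>
     (\<forall>P\<in>\<P>. P \<in> sets borel \<and> P \<subseteq> fund_domain \<alpha>) \<and>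
     pairwise disjnt \<P> \<and> ae_equal (fund_domain \<alpha>) (\<Union>\<P>)"

definition admits_finite_partition :: "real \<times> real \<Rightarrow> bool" where
  "admits_finite_partition \<alpha> \<longleftrightarrow>
     (\<exists>\<P>. finite \<P> \<and> is_partition \<alpha> \<P> \<and>
        (\<forall>b\<in>gaussian_integers. cylinder1 \<alpha> b \<noteq> {} \<longrightarrow>
          (\<forall>P\<in>\<P>. \<exists>\<Q>\<subseteq>\<P>. ae_equal (hurwitz_map \<alpha> ` (cylinder1 \<alpha> b \<inter> P)) (\<Union>\<Q>))))"

end

theory Submission
  imports Defs
begin

text \<open>The sets \<open>T\<^sup>n(\<Delta>(b\<^sub>1, \<dots>, b\<^sub>n))\<close> are bounded by images of the four sides of the square. Such an
  image lies on a circle or line \<open>a |z|\<^sup>2 + b Re z + c Im z + d = 0\<close> with integer coefficients, and the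
  discriminant \<open>b\<^sup>2 + c\<^sup>2 - 4 a d\<close> is invariant under inversion and Gaussian translations. If the point
  \<open>z\<close> of the circle is sent to \<open>w = 1/z - b\<close>, then the new leading coefficient is at most
  \<open>|z|\<^sup>2 |a| + O(1)\<close>. Both \<open>|z|\<close> and \<open>|w|\<close> are at most 1, and rationality of \<open>\<alpha>\<close> rules out that both
  are 1, so two consecutive steps contract uniformly and the leading coefficients stay bounded. Hence
  only finitely many circles occur as boundaries. Their complement has finitely many pieces, and each
  range set is a union of pieces.\<close>

section \<open>Integral circles and lines\<close>

type_synonym circline = "int \<times> int \<times> int \<times> int"

fun circ_eval :: "circline \<Rightarrow> complex \<Rightarrow> real" where
  "circ_eval (a, b, c, d) z = a * (cmod z)\<^sup>2 + b * Re z + c * Im z + d"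

text \<open>For \<open>a \<noteq> 0\<close> this is \<open>4 * a^2\<close> times the squared radius,
  for \<open>a = 0\<close> the squared length of the normal vector of the line.\<close>

fun circ_disc :: "circline \<Rightarrow> int" where
  "circ_disc (a, b, c, d) = b\<^sup>2 + c\<^sup>2 - 4 * a * d"

fun circ_lead :: "circline \<Rightarrow> int" where
  "circ_lead (a, b, c, d) = a"

definition circ_zeros :: "circline \<Rightarrow> complex set" where
  "circ_zeros g = {z. circ_eval g z = 0}"

text \<open>Coefficients of the image of the circle under \<open>z \<mapsto> 1 / z - (m + \<i> n)\<close>.\<close>

fun circ_step :: "int \<Rightarrow> int \<Rightarrow> circline \<Rightarrow> circline" where
  "circ_step m n (a, b, c, d) =
     (d, b + 2 * d * m, 2 * d * n - c, a + b * m - c * n + d * (m\<^sup>2 + n\<^sup>2))"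

lemma circ_disc_step: "circ_disc (circ_step m n g) = circ_disc g"
  by (cases g) (simp add: power2_eq_square algebra_simps)

text \<open>The new equation at \<open>w\<close> is the old one at \<open>1 / u\<close>, where
  \<open>u = w + Complex m n\<close>, with the denominator \<open>|u|^2\<close> cleared. Hence
  \<open>w\<close> lies on the new circle exactly if \<open>1 / u\<close> lies on the old
  one.\<close>

lemma circ_eval_step:
  assumes "w + Complex m n \<noteq> 0"
  shows "circ_eval (circ_step m n g) w =
    (cmod (w + Complex m n))\<^sup>2 * circ_eval g (1 / (w + Complex m n))"
proof -
  obtain a b c d where g: "g = (a, b, c, d)" by (cases g)
  define u where "u = w + Complex m n"
  have w: "w = u - Complex m n" and N: "(cmod u)\<^sup>2 \<noteq> 0"
    using assms by (auto simp: u_def)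
  have "Re (1 / u) = Re u / (cmod u)\<^sup>2" "Im (1 / u) = - Im u / (cmod u)\<^sup>2"
    by (simp_all add: Re_divide Im_divide cmod_power2)
  moreover have "(cmod (1 / u))\<^sup>2 = 1 / (cmod u)\<^sup>2"
    by (simp add: norm_divide power_divide)
  ultimately have "(cmod u)\<^sup>2 * circ_eval g (1 / u) = a + b * Re u - c * Im u + d * (cmod u)\<^sup>2"
    using N by (simp add: g field_simps)
  also have "\<dots> = circ_eval (circ_step m n g) w"
    by (simp add: g w cmod_power2) (simp add: power2_eq_square algebra_simps)
  finally show ?thesis by (simp add: u_def)
qed

text \<open>Completing the square: the gradient has squared length \<open>4 * a\<close> times the
  value of the equation plus the discriminant, so its length is constant along the circle.\<close>

lemma circ_gradient:
  assumes "circ_eval (a, b, c, d) z = 0"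
  shows "cmod (Complex (2 * a * Re z + b) (2 * a * Im z + c)) = sqrt (circ_disc (a, b, c, d))"
proof -
  have "(2 * a * Re z + b)\<^sup>2 + (2 * a * Im z + c)\<^sup>2 =
      4 * a * circ_eval (a, b, c, d) z + circ_disc (a, b, c, d)"
    by (simp add: cmod_power2) (simp add: power2_eq_square algebra_simps)
  then show ?thesis
    using assms by (simp add: cmod_def)
qed

text \<open>The new leading coefficient is \<open>d\<close>. On the circle
  \<open>d = a |z|^2 - <v, z>\<close> with \<open>v\<close> the gradient, whose length is known, so
  Cauchy-Schwarz gives the bound.\<close>

lemma circ_lead_step_bound:
  assumes "circ_eval g z = 0"
  shows "\<bar>circ_lead (circ_step m n g)\<bar> \<le> (cmod z)\<^sup>2 * \<bar>circ_lead g\<bar> + sqrt (circ_disc g) * cmod z"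
proof -
  obtain a b c d where g: "g = (a, b, c, d)" by (cases g)
  define v where "v = Complex (2 * a * Re z + b) (2 * a * Im z + c)"
  have "real_of_int d = a * (cmod z)\<^sup>2 - inner v z"
    using assms by (simp add: g v_def inner_complex_def cmod_power2) (simp add: power2_eq_square algebra_simps)
  also have "\<bar>\<dots>\<bar> \<le> \<bar>a * (cmod z)\<^sup>2\<bar> + \<bar>inner v z\<bar>" by simp
  also have "\<dots> \<le> (cmod z)\<^sup>2 * \<bar>a\<bar> + cmod v * cmod z"
    using Cauchy_Schwarz_ineq2[of v z] by (simp add: abs_mult)
  also have "cmod v = sqrt (circ_disc g)"
    using circ_gradient[of a b c d z] assms by (simp add: v_def g)
  finally show ?thesis by (simp add: g)
qed

lemma closed_circ_zeros: "closed (circ_zeros g)"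
proof -
  obtain a b c d where g: "g = (a, b, c, d)" by (cases g)
  show ?thesis
    unfolding circ_zeros_def g circ_eval.simps
    by (intro closed_Collect_eq continuous_intros)
qed

text \<open>A positive discriminant rules out a vanishing normal vector when \<open>a = 0\<close>,
  so the zero set is a line or is contained in a circle.\<close>

lemma negligible_circ_zeros:
  assumes "circ_disc g > 0"
  shows "negligible (circ_zeros g)"
proof -
  obtain a b c d where g: "g = (a, b, c, d)" by (cases g)
  show ?thesis
  proof (cases "a = 0")
    case True
    then have "Complex b c \<noteq> 0" using assms by (auto simp: g complex_eq_iff)
    moreover have "circ_zeros g = {z. inner (Complex b c) z = - d}"
      using True by (auto simp: circ_zeros_def g inner_complex_def)
    ultimately show ?thesis by (metis negligible_hyperplane)
  next
    case False
    have "circ_zeros g \<subseteq> sphere (Complex (- b / (2 * a)) (- c / (2 * a))) (sqrt (circ_disc g) / \<bar>2 * a\<bar>)"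
    proof
      fix z assume "z \<in> circ_zeros g"
      then have z: "circ_eval (a, b, c, d) z = 0" by (simp add: circ_zeros_def g)
      have "Complex (- b / (2 * a)) (- c / (2 * a)) - z =
          Complex (2 * a * Re z + b) (2 * a * Im z + c) / of_real (- 2 * a)"
        using False by (simp add: complex_eq_iff field_simps)
      then show "z \<in> sphere (Complex (- b / (2 * a)) (- c / (2 * a))) (sqrt (circ_disc g) / \<bar>2 * a\<bar>)"
        using circ_gradient[OF z] by (simp add: dist_norm norm_divide abs_mult g)
    qed
    then show ?thesis by (rule negligible_subset[OF negligible_sphere])
  qed
qed

text \<open>The leading coefficient and the gradient length at one point of bounded modulus bound
  \<open>b\<close> and \<open>c\<close>; the equation at that point then bounds \<open>d\<close>.
  Integrality gives finiteness.\<close>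

lemma finite_circlines_bounded:
  fixes R N :: real
  shows "finite {g. circ_disc g \<le> N \<and> \<bar>circ_lead g\<bar> \<le> N \<and>
    (\<exists>z. cmod z \<le> R \<and> circ_eval g z = 0)}" (is "finite ?G")
proof -
  \<comment> \<open>\<open>B\<close> below bounds \<open>b\<close> and \<open>c\<close>,
    \<open>|N| R^2 + 2 B |R|\<close> bounds \<open>d\<close>, and \<open>|N|\<close> bounds
    \<open>a\<close>; \<open>L\<close> is the sum of these, rounded up.\<close>
  define L where "L = \<lceil>sqrt N + 2 * \<bar>N\<bar> * \<bar>R\<bar> + \<bar>N\<bar> * R\<^sup>2 + 2 * (sqrt N + 2 * \<bar>N\<bar> * \<bar>R\<bar>) * \<bar>R\<bar> + \<bar>N\<bar>\<rceil>"
  have "?G \<subseteq> {- L..L} \<times> {- L..L} \<times> {- L..L} \<times> {- L..L}"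
  proof
    fix g assume "g \<in> ?G"
    moreover obtain a b c d where g: "g = (a, b, c, d)" by (cases g)
    ultimately obtain z where N: "\<bar>a\<bar> \<le> N" "circ_disc g \<le> N" and z: "cmod z \<le> R" "circ_eval (a, b, c, d) z = 0"
      by auto
    define B where "B = sqrt N + 2 * \<bar>N\<bar> * \<bar>R\<bar>"
    have a: "\<bar>real_of_int a\<bar> \<le> \<bar>N\<bar>" using N by linarith
    have re: "\<bar>Re z\<bar> \<le> \<bar>R\<bar>" and im: "\<bar>Im z\<bar> \<le> \<bar>R\<bar>"
      using abs_Re_le_cmod[of z] abs_Im_le_cmod[of z] z by linarith+
    have "cmod (Complex (2 * a * Re z + b) (2 * a * Im z + c)) \<le> sqrt N"
      using circ_gradient[OF z(2)] N(2) g by simp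
    then have *: "\<bar>2 * a * Re z + b\<bar> \<le> sqrt N" "\<bar>2 * a * Im z + c\<bar> \<le> sqrt N"
      using abs_Re_le_cmod abs_Im_le_cmod by (metis complex.sel order_trans)+
    have "\<bar>a * Re z\<bar> \<le> \<bar>N\<bar> * \<bar>R\<bar>" "\<bar>a * Im z\<bar> \<le> \<bar>N\<bar> * \<bar>R\<bar>"
      unfolding abs_mult using a re im by (intro mult_mono; simp)+
    with * have b: "\<bar>b\<bar> \<le> B" and c: "\<bar>c\<bar> \<le> B"
      unfolding B_def by linarith+
    have "\<bar>b * Re z\<bar> \<le> B * \<bar>R\<bar>" "\<bar>c * Im z\<bar> \<le> B * \<bar>R\<bar>"
      unfolding abs_mult using b c re im by (intro mult_mono; simp)+
    moreover have "\<bar>a * (cmod z)\<^sup>2\<bar> \<le> \<bar>N\<bar> * R\<^sup>2"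
      unfolding abs_mult using a z by (intro mult_mono) (auto intro: power_mono)
    ultimately have d: "\<bar>d\<bar> \<le> \<bar>N\<bar> * R\<^sup>2 + 2 * B * \<bar>R\<bar>"
      using z(2) unfolding circ_eval.simps by linarith
    have pos: "0 \<le> B" "0 \<le> 2 * B * \<bar>R\<bar>" "0 \<le> \<bar>N\<bar> * R\<^sup>2"
      using b by (auto intro: order_trans[of _ "\<bar>real_of_int b\<bar>"])
    have L: "B + \<bar>N\<bar> * R\<^sup>2 + 2 * B * \<bar>R\<bar> + \<bar>N\<bar> \<le> L" unfolding L_def B_def by linarith
    have "\<bar>a\<bar> \<le> L" "\<bar>b\<bar> \<le> L" "\<bar>c\<bar> \<le> L" "\<bar>d\<bar> \<le> L"
      using a b c d L pos by linarith+
    then show "g \<in> {- L..L} \<times> {- L..L} \<times> {- L..L} \<times> {- L..L}"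
      by (auto simp: g)
  qed
  then show ?thesis by (rule finite_subset) simp
qed

section \<open>Connected pieces of the complement of finitely many circles\<close>

text \<open>Inversion about \<open>p\<close> turns the circles through \<open>p\<close> into lines, whose cells are convex; a
  punctured neighbourhood of \<open>p\<close> becomes a union of four half planes.\<close>

lemma circline_cells_locally_finite:
  assumes "finite G"
  shows "\<exists>V \<C>. open V \<and> p \<in> V \<and> finite \<C> \<and>
    (\<forall>C\<in>\<C>. connected C \<and> C \<inter> (\<Union>g\<in>G. circ_zeros g) = {}) \<and> V - (\<Union>g\<in>G. circ_zeros g) \<subseteq> \<Union>\<C>"
proof -
  define K where "K = (\<Union>g\<in>G. circ_zeros g)"
  define G0 where "G0 = {g \<in> G. circ_eval g p = 0}"
  have "open (- (\<Union>g\<in>G - G0. circ_zeros g))"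
    using assms closed_circ_zeros by (intro open_Compl closed_UN) auto
  moreover have "p \<in> - (\<Union>g\<in>G - G0. circ_zeros g)"
    by (auto simp: G0_def circ_zeros_def)
  ultimately obtain e where e: "e > 0" "ball p e \<subseteq> - (\<Union>g\<in>G - G0. circ_zeros g)"
    by (metis open_contains_ball)
  \<comment> \<open>These half planes lie in \<open>|w| > 1 / e\<close>, so their images under
    \<open>p + 1 / w\<close> stay in \<open>ball p e\<close> and meet no circle of
    \<open>G - G0\<close>.\<close>
  define H :: "complex set set" where
    "H = {{w. Re w > 1/e}, {w. Re w < -(1/e)}, {w. Im w > 1/e}, {w. Im w < -(1/e)}}"
  \<comment> \<open>For \<open>g\<close> in \<open>G0\<close> and \<open>w \<noteq> 0\<close> this
    is \<open>|w|^2\<close> times the equation of \<open>g\<close> at \<open>p + 1 / w\<close>. The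
    quadratic part drops out because \<open>g\<close> vanishes at \<open>p\<close>.\<close>
  define l :: "circline \<Rightarrow> complex \<Rightarrow> real" where "l = (\<lambda>(a, b, c, d) w. real_of_int a +
    inner (Complex (2 * a * Re p + b) (- (2 * a * Im p + c))) w)"
  have l: "(cmod w)\<^sup>2 * circ_eval g (p + 1 / w) = l g w" if "g \<in> G0" "w \<noteq> 0" for g w
  proof -
    obtain a b c d where g: "g = (a, b, c, d)" by (cases g)
    have p: "a * (cmod p)\<^sup>2 + b * Re p + c * Im p + d = 0"
      using that by (simp add: G0_def g)
    have N: "(cmod w)\<^sup>2 \<noteq> 0" using that by simp
    have re: "Re (1 / w) = Re w / (cmod w)\<^sup>2" and im: "Im (1 / w) = - Im w / (cmod w)\<^sup>2"
      by (simp_all add: Re_divide Im_divide cmod_power2)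
    have "(cmod (1 / w))\<^sup>2 = 1 / (cmod w)\<^sup>2"
      by (simp add: norm_divide power_divide)
    moreover have "(cmod (p + 1 / w))\<^sup>2 =
        (cmod p)\<^sup>2 + 2 * (Re p * Re (1 / w) + Im p * Im (1 / w)) + (cmod (1 / w))\<^sup>2"
      unfolding cmod_power2 by (simp add: power2_eq_square algebra_simps)
    ultimately have "circ_eval g (p + 1 / w) =
        (a * (cmod p)\<^sup>2 + b * Re p + c * Im p + d) +
        (a / (cmod w)\<^sup>2 + (2 * a * Re p + b) * Re (1 / w) + (2 * a * Im p + c) * Im (1 / w))"
      by (simp add: g) (simp add: algebra_simps)
    also have "\<dots> = a / (cmod w)\<^sup>2 + (2 * a * Re p + b) * Re (1 / w) + (2 * a * Im p + c) * Im (1 / w)"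
      using p by simp
    finally have eq: "circ_eval g (p + 1 / w) = \<dots>" .
    show ?thesis
      unfolding eq re im using N by (simp add: l_def g inner_complex_def field_simps)
  qed
  define cell where "cell = (\<lambda>(h, S). h \<inter> (\<Inter>g\<in>S. {w. l g w > 0}) \<inter> (\<Inter>g\<in>G0 - S. {w. l g w < 0}))"
  have H: "w \<noteq> 0 \<and> 1 / cmod w < e" if "w \<in> h" "h \<in> H" for w h
  proof -
    have "1 / e < cmod w"
      using that abs_Re_le_cmod[of w] abs_Im_le_cmod[of w] unfolding H_def by auto
    moreover from this have "0 < cmod w"
      using e(1) by (metis divide_pos_pos less_trans zero_less_one)
    ultimately show ?thesis using e(1) by (auto simp: field_simps)
  qed
  have convex_cell: "convex (cell (h, S))" if "h \<in> H" for h S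
  proof -
    have gt: "convex {w. l g w > 0}" and lt: "convex {w. l g w < 0}" for g
    proof -
      obtain a b c d where g: "g = (a, b, c, d)" by (cases g)
      have "{w. l g w > 0} = {w. - real_of_int a < inner (Complex (2 * a * Re p + b) (- (2 * a * Im p + c))) w}"
        "{w. l g w < 0} = {w. inner (Complex (2 * a * Re p + b) (- (2 * a * Im p + c))) w < - real_of_int a}"
        by (auto simp: l_def g)
      then show "convex {w. l g w > 0}" "convex {w. l g w < 0}"
        by (simp_all only: convex_halfspace_gt convex_halfspace_lt)
    qed
    have "convex h"
      using that convex_halfspace_Re_gt convex_halfspace_Re_lt convex_halfspace_Im_gt convex_halfspace_Im_lt
      unfolding H_def by auto
    then show ?thesis
      unfolding cell_def by (auto intro!: convex_Int convex_INT gt lt)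
  qed
  \<comment> \<open>The inversion chart misses \<open>p\<close>, which is added as a piece of its
    own; that piece is empty if \<open>p\<close> lies on a circle.\<close>
  define \<C> where "\<C> = insert ({p} - K) ((\<lambda>x. (\<lambda>w. p + 1 / w) ` cell x) ` (H \<times> Pow G0))"
  have "finite \<C>"
    using assms by (auto simp: \<C>_def H_def G0_def)
  moreover have "connected C \<and> C \<inter> K = {}" if "C \<in> \<C>" for C
  proof (cases "C = {p} - K")
    case True
    then show ?thesis by (cases "p \<in> K") (simp_all add: insert_Diff_if)
  next
    case False
    then obtain h S where h: "h \<in> H" "S \<subseteq> G0" and C: "C = (\<lambda>w. p + 1 / w) ` cell (h, S)"
      using \<open>C \<in> \<C>\<close> False unfolding \<C>_def by blast
    have h': "w \<in> h" if "w \<in> cell (h, S)" for w using that by (simp add: cell_def)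
    have "continuous_on (cell (h, S)) (\<lambda>w. p + 1 / w)"
      using H h' h(1) by (intro continuous_intros) blast
    then have "connected C"
      unfolding C using convex_cell[OF h(1)] by (intro connected_continuous_image convex_connected)
    moreover have "p + 1 / w \<notin> circ_zeros g" if w: "w \<in> cell (h, S)" and g: "g \<in> G" for g w
    proof (cases "g \<in> G0")
      case True
      have "l g w > 0 \<or> l g w < 0"
        using w True by (cases "g \<in> S") (auto simp: cell_def)
      then have "l g w \<noteq> 0" by auto
      then show ?thesis using l[OF True, of w] H[OF h'[OF w] h(1)] by (auto simp: circ_zeros_def)
    next
      case False
      have "p + 1 / w \<in> ball p e"
        using H[OF h'[OF w] h(1)] by (simp add: dist_norm norm_divide)
      then show ?thesis using e False g by blast
    qed
    ultimately show ?thesis by (auto simp: C K_def)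
  qed
  \<comment> \<open>Halving the radius gives \<open>|w| > 2 / e\<close>, hence
    \<open>|Re w| + |Im w| > 2 / e\<close>, so one coordinate exceeds \<open>1 / e\<close> in
    absolute value.\<close>
  moreover have "z \<in> \<Union>\<C>" if z: "z \<in> ball p (e / 2)" "z \<notin> K" for z
  proof (cases "z = p")
    case True
    then show ?thesis using that by (auto simp: \<C>_def)
  next
    case False
    define w where "w = 1 / (z - p)"
    have w: "w \<noteq> 0" "z = p + 1 / w" using False by (auto simp: w_def)
    have "cmod (z - p) < e / 2" using z by (simp add: dist_norm norm_minus_commute)
    then have "cmod w > 2 / e"
      using False e(1) by (simp add: w_def norm_divide field_simps)
    then have "\<bar>Re w\<bar> + \<bar>Im w\<bar> > 2 * (1 / e)" using cmod_le[of w] by simp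
    then have "Re w > 1/e \<or> Re w < -(1/e) \<or> Im w > 1/e \<or> Im w < -(1/e)"
      by linarith
    then have "w \<in> \<Union>H"
      unfolding H_def by (auto simp only: Union_insert Un_iff mem_Collect_eq)
    then obtain h where h: "h \<in> H" "w \<in> h" by blast
    define S where "S = {g \<in> G0. l g w > 0}"
    have "l g w \<noteq> 0" if "g \<in> G0" for g
    proof -
      have "circ_eval g z \<noteq> 0" using z(2) that by (auto simp: K_def G0_def circ_zeros_def)
      then show ?thesis unfolding l[OF that w(1), symmetric] using w by simp
    qed
    then have "w \<in> cell (h, S)"
      using h by (auto simp: cell_def S_def linorder_neq_iff)
    then have "z \<in> (\<lambda>w. p + 1 / w) ` cell (h, S)" using w by auto
    moreover have "(h, S) \<in> H \<times> Pow G0" using h by (auto simp: S_def)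
    ultimately show ?thesis unfolding \<C>_def by blast
  qed
  moreover have "open (ball p (e / 2))" "p \<in> ball p (e / 2)" using e(1) by auto
  ultimately show ?thesis
    unfolding K_def[symmetric] by (metis (no_types, lifting) DiffE subsetI)
qed

text \<open>Compactness leaves finitely many of the local neighbourhoods. On each piece, membership
  in a set whose frontier lies on the circles is constant.\<close>

lemma circline_cells_finite:
  assumes "finite G" "compact Q"
  obtains \<C> where "finite \<C>" "\<And>C. C \<in> \<C> \<Longrightarrow> connected C"
    "\<And>C. C \<in> \<C> \<Longrightarrow> C \<inter> (\<Union>g\<in>G. circ_zeros g) = {}" "Q - (\<Union>g\<in>G. circ_zeros g) \<subseteq> \<Union>\<C>"
proof -
  define K where "K = (\<Union>g\<in>G. circ_zeros g)"
  have "\<forall>p. \<exists>V \<C>. open V \<and> p \<in> V \<and> finite \<C> \<and> (\<forall>C\<in>\<C>. connected C \<and> C \<inter> K = {}) \<and> V - K \<subseteq> \<Union>\<C>"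
    unfolding K_def using circline_cells_locally_finite[OF assms(1)] by blast
  then obtain V \<C> where V: "\<And>p. open (V p)" "\<And>p. p \<in> V p" "\<And>p. finite (\<C> p)"
    "\<And>p C. C \<in> \<C> p \<Longrightarrow> connected C \<and> C \<inter> K = {}" "\<And>p. V p - K \<subseteq> \<Union>(\<C> p)"
    by metis
  obtain P where P: "P \<subseteq> Q" "finite P" "Q \<subseteq> (\<Union>p\<in>P. V p)"
    by (rule compactE_image[OF assms(2), of Q V]) (use V(1,2) in auto)
  show ?thesis
  proof (rule that[of "\<Union>p\<in>P. \<C> p", folded K_def])
    show "Q - K \<subseteq> \<Union>(\<Union>p\<in>P. \<C> p)" using P V(5) by blast
    show "C \<inter> K = {}" if "C \<in> (\<Union>p\<in>P. \<C> p)" for C using that V(4) by blast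
  qed (use P V in auto)
qed

section \<open>The square and uniform contraction\<close>

text \<open>In \<open>(2 * m)^2 = 3 * n^2\<close> the multiplicity of 3 is even on the left and odd
  on the right. This excludes corners of modulus 1 with imaginary part \<open>1/2\<close> or
  \<open>-1/2\<close>.\<close>

lemma rational_square_neq_three_quarters:
  fixes x :: real
  assumes "x \<in> \<rat>"
  shows "4 * x\<^sup>2 \<noteq> 3"
proof
  assume eq: "4 * x\<^sup>2 = 3"
  obtain m n where n: "n \<noteq> 0" and x: "\<bar>x\<bar> = real m / real n"
    using Rats_abs_nat_div_natE[OF assms] by metis
  have "4 * (real m / real n)\<^sup>2 = 3" using eq x by (metis power2_abs)
  then have "real (2 ^ 2 * m ^ 2) = real (3 * n ^ 2)"
    using n by (simp add: field_simps)
  then have "2 ^ 2 * m ^ 2 = 3 * n ^ 2" by (simp only: of_nat_eq_iff)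
  then obtain k where k: "k ^ 2 = 3 * n ^ 2" by (metis power_mult_distrib)
  then have "k \<noteq> 0" using n by (cases k) auto
  moreover have "prime_elem (3::nat)" by simp
  moreover have "multiplicity 3 (k ^ 2) = multiplicity 3 (3 * n ^ 2)"
    using k by simp
  ultimately have "2 * multiplicity 3 k = Suc (2 * multiplicity 3 n)"
    using n by (simp add: prime_elem_multiplicity_power_distrib prime_elem_multiplicity_mult_distrib)
  then show False by presburger
qed

section \<open>The square, its corners and the compactness gap\<close>

definition closed_domain :: "real \<times> real \<Rightarrow> complex set" where
  "closed_domain \<alpha> =
     {z. fst \<alpha> - 1 \<le> Re z \<and> Re z \<le> fst \<alpha> \<and> snd \<alpha> - 1 \<le> Im z \<and> Im z \<le> snd \<alpha>}"

definition open_domain :: "real \<times> real \<Rightarrow> complex set" where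
  "open_domain \<alpha> =
     {z. fst \<alpha> - 1 < Re z \<and> Re z < fst \<alpha> \<and> snd \<alpha> - 1 < Im z \<and> Im z < snd \<alpha>}"

lemma closed_closed_domain: "closed (closed_domain \<alpha>)"
  unfolding closed_domain_def by (intro closed_Collect_conj closed_Collect_le continuous_intros)

lemma open_open_domain: "open (open_domain \<alpha>)"
  unfolding open_domain_def by (intro open_Collect_conj open_Collect_less continuous_intros)

lemma open_domain_subset: "open_domain \<alpha> \<subseteq> fund_domain \<alpha>"
  by (auto simp: open_domain_def fund_domain_def)

lemma closure_fund_domain_subset: "closure (fund_domain \<alpha>) \<subseteq> closed_domain \<alpha>"
  by (intro closure_minimal closed_closed_domain) (auto simp: closed_domain_def fund_domain_def)

lemma closed_gaussian_integers: "closed gaussian_integers"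
proof -
  have "gaussian_integers = Re -` \<int> \<inter> Im -` \<int>"
    by (auto simp: gaussian_integers_def)
  moreover have "closed (Re -` \<int> \<inter> Im -` \<int>)"
    by (intro closed_Int closed_vimage closed_Ints continuous_intros)
  ultimately show ?thesis by simp
qed

text \<open>\<open>u\<close> is the endpoint on the same side of 0 as \<open>x\<close>. Equality of
  squares then forces \<open>x = u\<close> even for \<open>a = 1/2\<close>, where both endpoints
  have the same square.\<close>

lemma square_le_endpoint:
  fixes a x :: real
  assumes "0 < a" "a < 1" "a - 1 \<le> x" "x \<le> a"
  obtains u where "u = a \<or> u = a - 1" "x\<^sup>2 \<le> u\<^sup>2" "x\<^sup>2 = u\<^sup>2 \<longrightarrow> x = u"
proof (cases "0 \<le> x")
  case True
  have "x\<^sup>2 \<le> a\<^sup>2" using assms True by (intro power_mono)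
  moreover have "x\<^sup>2 = a\<^sup>2 \<longrightarrow> x = a" using assms True by (simp add: power2_eq_iff)
  ultimately show ?thesis using that[of a] by blast
next
  case False
  have "(- x)\<^sup>2 \<le> (1 - a)\<^sup>2" using assms False by (intro power_mono) auto
  then have "x\<^sup>2 \<le> (a - 1)\<^sup>2" by (simp add: power2_commute)
  moreover have "x\<^sup>2 = (a - 1)\<^sup>2 \<longrightarrow> x = a - 1"
    using assms False by (simp add: power2_eq_iff)
  ultimately show ?thesis using that[of "a - 1"] by blast
qed

locale rational_domain =
  fixes \<alpha> :: "real \<times> real" and p q r s :: nat
  assumes pos: "0 < p" "0 < q" "0 < r" "0 < s"
    and \<alpha>: "\<alpha> = (real p / real q, real r / real s)"
    and admissible: "\<alpha> \<in> admissible_region"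
begin

lemma fst_pos: "0 < fst \<alpha>" and snd_pos: "0 < snd \<alpha>"
  using pos by (auto simp: \<alpha>)

text \<open>The corners of the square are the differences of \<open>\<alpha>\<close> and the four
  disc centers, so the discs bound the moduli of the corners; only the first disc is open.\<close>

lemma corner_bounds:
  "(fst \<alpha>)\<^sup>2 + (snd \<alpha>)\<^sup>2 < 1" "(fst \<alpha> - 1)\<^sup>2 + (snd \<alpha>)\<^sup>2 \<le> 1"
  "(fst \<alpha>)\<^sup>2 + (snd \<alpha> - 1)\<^sup>2 \<le> 1" "(fst \<alpha> - 1)\<^sup>2 + (snd \<alpha> - 1)\<^sup>2 \<le> 1"
proof -
  obtain a b where ab: "\<alpha> = (a, b)" by (cases \<alpha>)
  have "dist (0, 0) (a, b) < 1" "dist (1, 0) (a, b) \<le> 1" "dist (0, 1) (a, b) \<le> 1" "dist (1, 1) (a, b) \<le> 1"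
    using admissible unfolding ab admissible_region_def by auto
  then show "(fst \<alpha>)\<^sup>2 + (snd \<alpha>)\<^sup>2 < 1" "(fst \<alpha> - 1)\<^sup>2 + (snd \<alpha>)\<^sup>2 \<le> 1"
    "(fst \<alpha>)\<^sup>2 + (snd \<alpha> - 1)\<^sup>2 \<le> 1" "(fst \<alpha> - 1)\<^sup>2 + (snd \<alpha> - 1)\<^sup>2 \<le> 1"
    by (simp_all add: ab dist_Pair_Pair dist_real_def power2_commute)
qed

lemma fst_less_1: "fst \<alpha> < 1" and snd_less_1: "snd \<alpha> < 1"
proof -
  have "(fst \<alpha>)\<^sup>2 < 1\<^sup>2" "(snd \<alpha>)\<^sup>2 < 1\<^sup>2"
    using corner_bounds(1) zero_le_power2[of "fst \<alpha>"] zero_le_power2[of "snd \<alpha>"] by (simp; linarith)+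
  then show "fst \<alpha> < 1" "snd \<alpha> < 1" by (auto intro: power2_less_imp_less)
qed

lemma corner_norm_le:
  assumes "u = fst \<alpha> \<or> u = fst \<alpha> - 1" "v = snd \<alpha> \<or> v = snd \<alpha> - 1"
  shows "u\<^sup>2 + v\<^sup>2 \<le> 1"
  using assms corner_bounds by auto

text \<open>Replacing each coordinate by the endpoint on its side of 0 moves \<open>z\<close> to a
  corner without decreasing the modulus; if \<open>z\<close> has modulus 1, nothing can have
  moved.\<close>

lemma closed_domain_norm_le:
  assumes "z \<in> closed_domain \<alpha>"
  shows "(cmod z)\<^sup>2 \<le> 1"
    and "(cmod z)\<^sup>2 = 1 \<longrightarrow> (Re z = fst \<alpha> \<or> Re z = fst \<alpha> - 1) \<and> (Im z = snd \<alpha> \<or> Im z = snd \<alpha> - 1)"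
proof -
  obtain u where u: "u = fst \<alpha> \<or> u = fst \<alpha> - 1" "(Re z)\<^sup>2 \<le> u\<^sup>2" "(Re z)\<^sup>2 = u\<^sup>2 \<longrightarrow> Re z = u"
    using square_le_endpoint[of "fst \<alpha>" "Re z"] fst_pos fst_less_1 assms by (auto simp: closed_domain_def)
  obtain v where v: "v = snd \<alpha> \<or> v = snd \<alpha> - 1" "(Im z)\<^sup>2 \<le> v\<^sup>2" "(Im z)\<^sup>2 = v\<^sup>2 \<longrightarrow> Im z = v"
    using square_le_endpoint[of "snd \<alpha>" "Im z"] snd_pos snd_less_1 assms by (auto simp: closed_domain_def)
  have "u\<^sup>2 + v\<^sup>2 \<le> 1" using corner_norm_le u v by blast
  with u(2) v(2) show "(cmod z)\<^sup>2 \<le> 1" unfolding cmod_power2 by linarith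
  show "(cmod z)\<^sup>2 = 1 \<longrightarrow> (Re z = fst \<alpha> \<or> Re z = fst \<alpha> - 1) \<and> (Im z = snd \<alpha> \<or> Im z = snd \<alpha> - 1)"
  proof
    assume "(cmod z)\<^sup>2 = 1"
    then have "(Re z)\<^sup>2 = u\<^sup>2" "(Im z)\<^sup>2 = v\<^sup>2"
      using \<open>u\<^sup>2 + v\<^sup>2 \<le> 1\<close> u(2) v(2) unfolding cmod_power2 by linarith+
    then show "(Re z = fst \<alpha> \<or> Re z = fst \<alpha> - 1) \<and> (Im z = snd \<alpha> \<or> Im z = snd \<alpha> - 1)"
      using u v by metis
  qed
qed

text \<open>This is the only place where rationality is used for more than discreteness: for irrational
  \<open>\<alpha>\<close> both points could be corners on the unit circle with imaginary parts \<open>\<plusminus>1/2\<close>.\<close>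

lemma not_both_unimodular:
  assumes z: "z \<in> closed_domain \<alpha>" and w: "w \<in> closed_domain \<alpha>"
    and int: "1 / z - w \<in> gaussian_integers" and norm: "cmod z = 1"
  shows "cmod w < 1"
proof -
  have re_z: "Re z = fst \<alpha> \<or> Re z = fst \<alpha> - 1" and im_z: "Im z = snd \<alpha> \<or> Im z = snd \<alpha> - 1"
    using closed_domain_norm_le(2)[OF z] norm by auto
  have n: "(Re z)\<^sup>2 + (Im z)\<^sup>2 = 1" using norm by (metis cmod_power2 one_power2)
  \<comment> \<open>On the unit circle \<open>1 / z\<close> is the conjugate of
    \<open>z\<close>.\<close>
  have inv: "Re (1 / z) = Re z" "Im (1 / z) = - Im z" using n by (simp_all add: Re_divide Im_divide)
  obtain j k :: int where "Re (1 / z - w) = of_int j" "Im (1 / z - w) = of_int k"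
    using int unfolding gaussian_integers_def by (auto elim!: Ints_cases)
  then have w_eq: "Re w = Re z - of_int j" "Im w = - Im z - of_int k" using inv by auto
  \<comment> \<open>\<open>Re z\<close> is an endpoint of an interval of length 1; an integer shift
    of it that stays in the interval is again an endpoint.\<close>
  have "j \<in> {-1, 0, 1}"
  proof -
    have "real_of_int j < 2" "- 2 < real_of_int j" using w w_eq re_z by (auto simp: closed_domain_def)
    then show ?thesis by auto
  qed
  then have re_w: "Re w = fst \<alpha> \<or> Re w = fst \<alpha> - 1"
    using w w_eq re_z by (auto simp: closed_domain_def)
  have irr: "(Im z)\<^sup>2 \<noteq> (1/2)\<^sup>2"
  proof
    assume "(Im z)\<^sup>2 = (1/2)\<^sup>2"
    then have "4 * (Re z)\<^sup>2 = 3" using n by (simp add: power2_eq_square)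
    moreover have "Re z \<in> \<rat>" using re_z by (auto simp: \<alpha>)
    ultimately show False using rational_square_neq_three_quarters by blast
  qed
  \<comment> \<open>The corner with the same real part and the other imaginary part also has modulus
    at most 1, so \<open>Im z\<close> is the endpoint farther from 0, strictly so by
    \<open>irr\<close>. Then \<open>- Im z\<close> is outside the interval, and the shift bringing
    it back lands on minus the nearer endpoint.\<close>
  have "\<bar>Im w\<bar> < \<bar>Im z\<bar>"
    using im_z
  proof
    assume y: "Im z = snd \<alpha>"
    have "(Re z)\<^sup>2 + (snd \<alpha> - 1)\<^sup>2 \<le> 1" using corner_norm_le re_z by blast
    then have "(1 - snd \<alpha>)\<^sup>2 \<le> (snd \<alpha>)\<^sup>2" using n y by (simp add: power2_commute)
    then have "1 - snd \<alpha> \<le> snd \<alpha>"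
      by (rule power2_le_imp_le) (simp add: snd_pos less_imp_le)
    moreover have "snd \<alpha> \<noteq> 1 / 2" using irr y by metis
    ultimately have half: "1 / 2 < snd \<alpha>" by linarith
    have "of_int k < (0::real)" "of_int k > (-2::real)"
      using w w_eq y half snd_less_1 by (auto simp: closed_domain_def)
    then have "k = -1" by linarith
    then show ?thesis using w_eq y half snd_less_1 by simp
  next
    assume y: "Im z = snd \<alpha> - 1"
    have "(Re z)\<^sup>2 + (snd \<alpha>)\<^sup>2 \<le> 1" using corner_norm_le re_z by blast
    then have "(snd \<alpha>)\<^sup>2 \<le> (1 - snd \<alpha>)\<^sup>2" using n y by (simp add: power2_commute)
    then have "snd \<alpha> \<le> 1 - snd \<alpha>"
      by (rule power2_le_imp_le) (simp add: snd_less_1 less_imp_le)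
    moreover have "snd \<alpha> \<noteq> 1 / 2"
    proof
      assume "snd \<alpha> = 1 / 2"
      then have "Im z = - (1 / 2)" using y by simp
      then show False using irr by simp
    qed
    ultimately have half: "snd \<alpha> < 1 / 2" by linarith
    have "of_int k < (2::real)" "of_int k > (0::real)"
      using w w_eq y half snd_pos by (auto simp: closed_domain_def)
    then have "k = 1" by linarith
    then show ?thesis using w_eq y half snd_pos by simp
  qed
  then have "(Im w)\<^sup>2 < (Im z)\<^sup>2" by (metis abs_le_square_iff not_le)
  \<comment> \<open>\<open>(Re w, Im z)\<close> is itself a corner.\<close>
  moreover have "(Re w)\<^sup>2 + (Im z)\<^sup>2 \<le> 1" using corner_norm_le re_w im_z by blast
  ultimately have "(cmod w)\<^sup>2 < 1\<^sup>2" unfolding cmod_power2 by simp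
  then show ?thesis by (rule power2_less_imp_less) simp
qed

text \<open>Away from \<open>z = 0\<close> the right side is continuous on a compact set and
  positive by \<open>not_both_unimodular\<close>, so it has a positive minimum. The square in the
  second summand fits the identity \<open>t (2 - t) + (1 - t)^2 = 1\<close> used in
  \<open>controlled_step\<close>.\<close>

lemma uniform_gap:
  obtains \<delta> where "0 < \<delta>" "\<And>z w. z \<in> closed_domain \<alpha> \<Longrightarrow> w \<in> closed_domain \<alpha> \<Longrightarrow> z \<noteq> 0 \<Longrightarrow>
    1 / z - w \<in> gaussian_integers \<Longrightarrow> \<delta> \<le> (1 - (cmod w)\<^sup>2) + (1 - (cmod z)\<^sup>2)\<^sup>2"
proof -
  define F where "F = (\<lambda>x. (1 - (cmod (snd x))\<^sup>2) + (1 - (cmod (fst x))\<^sup>2)\<^sup>2)"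
  define Q where "Q = (closed_domain \<alpha> - ball 0 (1/2)) \<times> closed_domain \<alpha>"
  define S where "S = Q \<inter> (\<lambda>x. 1 / fst x - snd x) -` gaussian_integers"
  have Q: "closed Q"
    unfolding Q_def by (intro closed_Times closed_Diff closed_closed_domain open_ball)
  have nz: "fst x \<noteq> 0" if "x \<in> Q" for x using that by (auto simp: Q_def)
  have "closed S"
    unfolding S_def using nz
    by (intro continuous_closed_preimage Q closed_gaussian_integers continuous_intros) auto
  moreover have "bounded S"
  proof -
    have "closed_domain \<alpha> \<subseteq> cball 0 1"
      using closed_domain_norm_le(1) by (auto simp: abs_square_le_1)
    then have "bounded (closed_domain \<alpha>)" using bounded_cball bounded_subset by blast
    then have "bounded (closed_domain \<alpha> \<times> closed_domain \<alpha>)" by (intro bounded_Times)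
    then show ?thesis by (rule bounded_subset) (auto simp: S_def Q_def)
  qed
  ultimately have "compact S" by (simp add: compact_eq_bounded_closed)
  have F_pos: "0 < F x" if x: "x \<in> S" for x
  proof -
    have z: "fst x \<in> closed_domain \<alpha>" and w: "snd x \<in> closed_domain \<alpha>"
      and i: "1 / fst x - snd x \<in> gaussian_integers" using x by (auto simp: S_def Q_def)
    have "0 \<le> 1 - (cmod (snd x))\<^sup>2" using closed_domain_norm_le(1)[OF w] by simp
    moreover have "0 < 1 - (cmod (snd x))\<^sup>2" if "cmod (fst x) = 1"
      using not_both_unimodular[OF z w i that] by (simp add: abs_square_less_1)
    moreover have "0 < (1 - (cmod (fst x))\<^sup>2)\<^sup>2" if "cmod (fst x) \<noteq> 1"
      using that by (simp add: power2_eq_1_iff) (metis norm_ge_zero not_one_le_zero order_trans zero_le_numeral neg_0_le_iff_le)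
    ultimately show ?thesis
      unfolding F_def by (cases "cmod (fst x) = 1") (auto intro: add_pos_nonneg add_nonneg_pos)
  qed
  obtain \<delta> where \<delta>: "0 < \<delta>" "\<And>x. x \<in> S \<Longrightarrow> \<delta> \<le> F x"
  proof (cases "S = {}")
    case True
    then show ?thesis using that[of 1] by auto
  next
    case False
    have "continuous_on S F" unfolding F_def by (intro continuous_intros)
    then obtain x where "x \<in> S" "\<forall>y\<in>S. F x \<le> F y"
      using continuous_attains_inf[OF \<open>compact S\<close> False] by blast
    then show ?thesis using that[of "F x"] F_pos by auto
  qed
  \<comment> \<open>For \<open>|z| < 1/2\<close> the second summand is at least
    \<open>(3/4)^2 = 9/16\<close>, which exceeds the \<open>1/2\<close> in the minimum.\<close>
  show ?thesis
  proof (rule that[of "min \<delta> (1/2)"])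
    fix z w assume *: "z \<in> closed_domain \<alpha>" "w \<in> closed_domain \<alpha>" "z \<noteq> 0" "1 / z - w \<in> gaussian_integers"
    show "min \<delta> (1/2) \<le> (1 - (cmod w)\<^sup>2) + (1 - (cmod z)\<^sup>2)\<^sup>2"
    proof (cases "cmod z < 1/2")
      case True
      have "(cmod z)\<^sup>2 \<le> (1/2)\<^sup>2" using True by (intro power_mono) auto
      then have "(3/4)\<^sup>2 \<le> (1 - (cmod z)\<^sup>2)\<^sup>2" by (intro power_mono) (auto simp: power2_eq_square)
      moreover have "0 \<le> 1 - (cmod w)\<^sup>2" using closed_domain_norm_le(1)[OF *(2)] by simp
      ultimately show ?thesis by (simp add: power2_eq_square)
    next
      case False
      then have "(z, w) \<in> S" using * by (auto simp: S_def Q_def)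
      from \<delta>(2)[OF this] show ?thesis by (simp add: F_def)
    qed
  qed (use \<delta> in auto)
qed

end

section \<open>Range sets and their frontiers\<close>

text \<open>The image \<open>T\<^sup>n(\<Delta>(b\<^sub>1, \<dots>, b\<^sub>n))\<close>, with the digits listed last first, so that applying the map
  once more conses a digit.\<close>

fun range_set :: "real \<times> real \<Rightarrow> complex list \<Rightarrow> complex set" where
  "range_set \<alpha> [] = fund_domain \<alpha>"
| "range_set \<alpha> (b # bs) = {w \<in> fund_domain \<alpha>. w + b \<noteq> 0 \<and> 1 / (w + b) \<in> range_set \<alpha> bs}"

lemma hurwitz_floor_eqI:
  assumes "b \<in> gaussian_integers" "z - b \<in> fund_domain \<alpha>"
  shows "hurwitz_floor \<alpha> z = b"
  unfolding hurwitz_floor_def using hurwitz_floor_ex1[of z \<alpha>] assms by (blast intro: the1_equality)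

lemma hurwitz_map_mem: "hurwitz_map \<alpha> z \<in> fund_domain \<alpha>"
  using theI'[OF hurwitz_floor_ex1[of "1 / z" \<alpha>]]
  by (simp add: hurwitz_map_def hurwitz_floor_def)

text \<open>The inverse branch on \<open>cylinder1 \<alpha> b\<close> is \<open>1 / (w + b)\<close>:
  for \<open>w\<close> in the square, uniqueness of the floor forces the digit \<open>b\<close>.
  Images thus become preimages.\<close>

lemma hurwitz_map_image:
  assumes b: "b \<in> gaussian_integers" and P: "P \<subseteq> fund_domain \<alpha>"
  shows "hurwitz_map \<alpha> ` (cylinder1 \<alpha> b \<inter> P) = {w \<in> fund_domain \<alpha>. w + b \<noteq> 0 \<and> 1 / (w + b) \<in> P}"
proof (intro equalityI subsetI)
  fix w assume "w \<in> hurwitz_map \<alpha> ` (cylinder1 \<alpha> b \<inter> P)"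
  then obtain z where z: "z \<in> P" "z \<noteq> 0" "hurwitz_floor \<alpha> (1 / z) = b" "w = hurwitz_map \<alpha> z"
    by (auto simp: cylinder1_def)
  then have "w + b = 1 / z" by (simp add: hurwitz_map_def)
  then show "w \<in> {w \<in> fund_domain \<alpha>. w + b \<noteq> 0 \<and> 1 / (w + b) \<in> P}"
    using z hurwitz_map_mem by auto
next
  fix w assume w: "w \<in> {w \<in> fund_domain \<alpha>. w + b \<noteq> 0 \<and> 1 / (w + b) \<in> P}"
  define z where "z = 1 / (w + b)"
  have z: "1 / z = w + b" "z \<noteq> 0" "z \<in> P" using w by (auto simp: z_def)
  have fl: "hurwitz_floor \<alpha> (1 / z) = b"
    using hurwitz_floor_eqI[OF b, of "1 / z" \<alpha>] w z(1) by simp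
  then have "hurwitz_map \<alpha> z = w" using z(1) by (simp add: hurwitz_map_def)
  moreover have "z \<in> cylinder1 \<alpha> b \<inter> P" using z fl P by (auto simp: cylinder1_def)
  ultimately show "w \<in> hurwitz_map \<alpha> ` (cylinder1 \<alpha> b \<inter> P)" by blast
qed

lemma cylinder_Cons: "cylinder \<alpha> (b # bs) = {z \<in> cylinder1 \<alpha> b. hurwitz_map \<alpha> z \<in> cylinder \<alpha> bs}"
  by (cases bs) (auto simp: hurwitz_map_mem)

lemma cylinder_snoc:
  "cylinder \<alpha> (bs @ [b]) = {z \<in> cylinder \<alpha> bs. (hurwitz_map \<alpha> ^^ length bs) z \<in> cylinder1 \<alpha> b}"
proof (induction bs)
  case Nil
  then show ?case by (auto simp: cylinder1_def)
next
  case (Cons c bs)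
  then show ?case
    by (auto simp: cylinder_Cons funpow_swap1 simp del: cylinder.simps)
qed

lemma range_set_subset: "range_set \<alpha> bs \<subseteq> fund_domain \<alpha>"
  by (cases bs) auto

text \<open>Induction on the last digit: the image for \<open>bs @ [b]\<close> is the map applied to
  the part of the image for \<open>bs\<close> inside \<open>cylinder1 \<alpha> b\<close>, which is
  one \<open>Cons\<close> step of \<open>range_set\<close>.\<close>

lemma hurwitz_map_funpow_image:
  assumes "set bs \<subseteq> gaussian_integers"
  shows "(hurwitz_map \<alpha> ^^ length bs) ` cylinder \<alpha> bs = range_set \<alpha> (rev bs)"
  using assms
proof (induction bs rule: rev_induct)
  case Nil
  then show ?case by simp
next
  case (snoc b bs)
  have "(hurwitz_map \<alpha> ^^ length (bs @ [b])) ` cylinder \<alpha> (bs @ [b]) =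
      hurwitz_map \<alpha> ` (cylinder1 \<alpha> b \<inter> (hurwitz_map \<alpha> ^^ length bs) ` cylinder \<alpha> bs)"
    by (auto simp: cylinder_snoc)
  also have "\<dots> = range_set \<alpha> (rev (bs @ [b]))"
    using snoc hurwitz_map_image[of b "range_set \<alpha> (rev bs)"] range_set_subset by simp
  finally show ?case .
qed

section \<open>Frontier points and the weighted bound on leading coefficients\<close>

context rational_domain
begin

text \<open>The frontier of a range set consists of points carrying a circle whose leading coefficient is
  controlled by the weight \<open>2 - |w|\<^sup>2\<close>. The weight is what makes the induction work: near the unit
  circle a single step need not shrink the leading coefficient, but two consecutive ones do.\<close>

definition controlled :: "real \<Rightarrow> circline \<Rightarrow> complex \<Rightarrow> bool" where
  "controlled M g w \<longleftrightarrow> w \<in> closed_domain \<alpha> \<and> circ_eval g w = 0 \<and>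
     circ_disc g \<in> {(int q)\<^sup>2, (int s)\<^sup>2} \<and> \<bar>circ_lead g\<bar> \<le> M * (2 - (cmod w)\<^sup>2)"

text \<open>Rationality puts the sides on integral lines such as \<open>q * Re w - p = 0\<close>,
  with leading coefficient 0 and discriminant \<open>q^2\<close> or \<open>s^2\<close>.\<close>

lemma controlled_edge:
  assumes "0 \<le> M" "w \<in> closed_domain \<alpha>" "w \<notin> open_domain \<alpha>"
  shows "\<exists>g. controlled M g w"
proof -
  have M: "0 \<le> M * (2 - (cmod w)\<^sup>2)"
    using assms(1) closed_domain_norm_le(1)[OF assms(2)] by simp
  have *: "\<exists>g. controlled M g w"
    if "circ_eval g w = 0" "circ_disc g \<in> {(int q)\<^sup>2, (int s)\<^sup>2}" "circ_lead g = 0" for g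
    by (rule exI[of _ g]) (use that M assms(2) in \<open>simp add: controlled_def\<close>)
  have "Re w = fst \<alpha> \<or> Re w = fst \<alpha> - 1 \<or> Im w = snd \<alpha> \<or> Im w = snd \<alpha> - 1"
    using assms by (auto simp: closed_domain_def open_domain_def)
  then show ?thesis
  proof (elim disjE)
    assume "Re w = fst \<alpha>"
    then show ?thesis using pos by (intro *[of "(0, int q, 0, - int p)"]) (auto simp: \<alpha>)
  next
    assume "Re w = fst \<alpha> - 1"
    then show ?thesis using pos
      by (intro *[of "(0, int q, 0, int q - int p)"]) (auto simp: \<alpha> field_simps)
  next
    assume "Im w = snd \<alpha>"
    then show ?thesis using pos by (intro *[of "(0, 0, int s, - int r)"]) (auto simp: \<alpha>)
  next
    assume "Im w = snd \<alpha> - 1"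
    then show ?thesis using pos
      by (intro *[of "(0, 0, int s, int s - int r)"]) (auto simp: \<alpha> field_simps)
  qed
qed

text \<open>With \<open>t = |z|^2\<close> the new leading coefficient is at most
  \<open>t M (2 - t) + M \<delta>\<close>. Inserting the gap and
  \<open>t (2 - t) + (1 - t)^2 = 1\<close> leaves exactly \<open>M (2 - |w|^2)\<close>, so the
  invariant persists with the same \<open>M\<close>.\<close>

lemma controlled_step:
  assumes gap: "\<And>z w. z \<in> closed_domain \<alpha> \<Longrightarrow> w \<in> closed_domain \<alpha> \<Longrightarrow> z \<noteq> 0 \<Longrightarrow>
      1 / z - w \<in> gaussian_integers \<Longrightarrow> \<delta> \<le> (1 - (cmod w)\<^sup>2) + (1 - (cmod z)\<^sup>2)\<^sup>2"
    and M: "0 \<le> M" "real q + real s \<le> M * \<delta>"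
    and b: "b \<in> gaussian_integers" and w: "w \<in> closed_domain \<alpha>" "w + b \<noteq> 0"
    and g: "controlled M g (1 / (w + b))"
  shows "\<exists>g. controlled M g w"
proof -
  define z where "z = 1 / (w + b)"
  have z: "z \<in> closed_domain \<alpha>" "circ_eval g z = 0" "circ_disc g \<in> {(int q)\<^sup>2, (int s)\<^sup>2}"
    "\<bar>circ_lead g\<bar> \<le> M * (2 - (cmod z)\<^sup>2)"
    using g unfolding controlled_def z_def by auto
  have z': "1 / z = w + b" "z \<noteq> 0" using w by (auto simp: z_def)
  define t where "t = (cmod z)\<^sup>2"
  have t: "0 \<le> t" "t \<le> 1" "cmod z \<le> 1"
    using closed_domain_norm_le(1)[OF z(1)] by (auto simp: t_def abs_square_le_1)
  obtain m n where mn: "b = Complex (of_int m) (of_int n)"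
    using b by (auto simp: gaussian_integers_def complex_eq_iff elim!: Ints_cases)
  define g' where "g' = circ_step m n g"
  have "circ_eval g' w = 0"
    using circ_eval_step[of w m n g] w z(2) by (simp add: g'_def mn z_def)
  moreover have "circ_disc g' \<in> {(int q)\<^sup>2, (int s)\<^sup>2}"
    using z(3) by (simp add: g'_def circ_disc_step)
  moreover have "\<bar>circ_lead g'\<bar> \<le> M * (2 - (cmod w)\<^sup>2)"
  proof -
    have "sqrt (circ_disc g) \<le> real q + real s" using z(3) by auto
    then have "sqrt (circ_disc g) * cmod z \<le> (real q + real s) * 1"
      using t by (intro mult_mono) auto
    moreover have "t * \<bar>circ_lead g\<bar> \<le> t * (M * (2 - t))"
      using z(4) t by (intro mult_left_mono) (auto simp: t_def)
    ultimately have "t * \<bar>circ_lead g\<bar> + sqrt (circ_disc g) * cmod z \<le> t * (M * (2 - t)) + M * \<delta>"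
      using M(2) by simp
    then have "\<bar>circ_lead g'\<bar> \<le> t * (M * (2 - t)) + M * \<delta>"
      using circ_lead_step_bound[OF z(2), of m n] unfolding g'_def t_def by (rule order_trans[rotated])
    also have "\<delta> \<le> (1 - (cmod w)\<^sup>2) + (1 - t)\<^sup>2"
      using gap[OF z(1) w(1)] z' b by (simp add: t_def)
    then have "t * (M * (2 - t)) + M * \<delta> \<le> t * (M * (2 - t)) + M * ((1 - (cmod w)\<^sup>2) + (1 - t)\<^sup>2)"
      using M(1) by (intro add_left_mono mult_left_mono)
    also have "\<dots> = M * (2 - (cmod w)\<^sup>2)" by (simp add: power2_eq_square algebra_simps)
    finally show ?thesis .
  qed
  ultimately show ?thesis using w(1) unfolding controlled_def by blast
qed

text \<open>Induction on the digits. A frontier point on a side of the square carries the line of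
  that side. One in the open square is sent by \<open>1 / (w + b)\<close> to a frontier point of the
  previous range set, and the circle there is transported back by
  \<open>controlled_step\<close>.\<close>

lemma frontier_range_set_controlled:
  assumes gap: "\<And>z w. z \<in> closed_domain \<alpha> \<Longrightarrow> w \<in> closed_domain \<alpha> \<Longrightarrow> z \<noteq> 0 \<Longrightarrow>
      1 / z - w \<in> gaussian_integers \<Longrightarrow> \<delta> \<le> (1 - (cmod w)\<^sup>2) + (1 - (cmod z)\<^sup>2)\<^sup>2"
    and M: "0 \<le> M" "real q + real s \<le> M * \<delta>"
    and bs: "set bs \<subseteq> gaussian_integers" and w: "w \<in> frontier (range_set \<alpha> bs)"
  shows "\<exists>g. controlled M g w"
  using bs w
proof (induction bs arbitrary: w)
  case Nil
  have "w \<in> closed_domain \<alpha>"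
    using Nil closure_fund_domain_subset[of \<alpha>] by (auto simp: frontier_def)
  moreover have "w \<notin> open_domain \<alpha>"
    using Nil interior_maximal[OF open_domain_subset[of \<alpha>] open_open_domain] by (auto simp: frontier_def)
  ultimately show ?case using controlled_edge M(1) by blast
next
  case (Cons b bs)
  have w: "w \<in> closure (range_set \<alpha> (b # bs))" "w \<notin> interior (range_set \<alpha> (b # bs))"
    using Cons.prems by (auto simp: frontier_def)
  have wc: "w \<in> closed_domain \<alpha>"
    using w(1) closure_mono[OF range_set_subset] closure_fund_domain_subset by blast
  show ?case
  proof (cases "w \<in> open_domain \<alpha>")
    case False
    then show ?thesis using controlled_edge M(1) wc by blast
  next
    case True
    \<comment> \<open>Since the square lies in the closed unit disc, the range set keeps distance at
      least 1 from the pole \<open>- b\<close>, and so does its closure.\<close>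
    have sub: "range_set \<alpha> (b # bs) \<subseteq> - ball (- b) 1"
    proof
      fix v assume "v \<in> range_set \<alpha> (b # bs)"
      then have v: "v + b \<noteq> 0" "1 / (v + b) \<in> fund_domain \<alpha>" using range_set_subset[of \<alpha> bs] by auto
      then have "(cmod (1 / (v + b)))\<^sup>2 \<le> 1"
        using closed_domain_norm_le(1) closure_fund_domain_subset[of \<alpha>] closure_subset by blast
      then have "cmod (1 / (v + b)) \<le> 1" by (simp add: abs_square_le_1)
      then have "1 \<le> cmod (v + b)" using v(1) by (simp add: norm_divide divide_le_eq)
      moreover have "dist (- b) v = cmod (v + b)"
        by (simp add: dist_norm) (metis add.commute minus_add_distrib norm_minus_cancel uminus_add_conv_diff diff_minus_eq_add minus_diff_eq)
      ultimately show "v \<in> - ball (- b) 1" by simp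
    qed
    have "w \<in> - ball (- b) 1"
      using w(1) closure_minimal[OF sub] by (auto simp: closed_Compl)
    then have nz: "w + b \<noteq> 0" by (auto simp: add_eq_0_iff)
    define \<psi> where "\<psi> = (\<lambda>v. 1 / (v + b))"
    have cont: "isCont \<psi> w" unfolding \<psi>_def using nz by (intro continuous_intros)
    have "\<psi> w \<in> closure (range_set \<alpha> bs)"
    proof -
      obtain v where v: "\<And>i. v i \<in> range_set \<alpha> (b # bs)" "v \<longlonglongrightarrow> w"
        using w(1) by (auto simp: closure_sequential)
      have "(\<lambda>i. \<psi> (v i)) \<longlonglongrightarrow> \<psi> w"
        using cont v(2) by (rule isCont_tendsto_compose)
      moreover have "\<psi> (v i) \<in> range_set \<alpha> bs" for i using v(1)[of i] by (simp add: \<psi>_def)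
      ultimately show ?thesis
        unfolding closure_sequential by (intro exI[of _ "\<lambda>i. \<psi> (v i)"]) simp
    qed
    \<comment> \<open>Otherwise continuity would give a neighbourhood of \<open>w\<close> inside the
      range set, as \<open>w\<close> is in the open square and off the pole.\<close>
    moreover have "\<psi> w \<notin> interior (range_set \<alpha> bs)"
    proof
      assume int: "\<psi> w \<in> interior (range_set \<alpha> bs)"
      have "\<forall>\<^sub>F v in nhds w. \<psi> v \<in> interior (range_set \<alpha> bs)"
        using cont int by (auto simp: isCont_def eventually_nhds_conv_at dest!: topological_tendstoD[OF _ open_interior])
      moreover have "\<forall>\<^sub>F v in nhds w. v \<in> open_domain \<alpha>"
        using open_open_domain True by (rule eventually_nhds_in_open)
      moreover have "\<forall>\<^sub>F v in nhds w. v \<in> - {- b}"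
        by (rule eventually_nhds_in_open) (use nz in auto)
      ultimately have "\<forall>\<^sub>F v in nhds w. v \<in> range_set \<alpha> (b # bs)"
      proof eventually_elim
        case (elim v)
        then show ?case
          using open_domain_subset[of \<alpha>] interior_subset[of "range_set \<alpha> bs"]
          by (auto simp: \<psi>_def eq_neg_iff_add_eq_0)
      qed
      then show False
        using w(2) by (auto simp: eventually_nhds interior_def)
    qed
    ultimately have "\<psi> w \<in> frontier (range_set \<alpha> bs)" by (simp add: frontier_def)
    then obtain g where "controlled M g (1 / (w + b))"
      using Cons.IH Cons.prems(1) unfolding \<psi>_def by (metis list.set_intros(2) subset_iff)
    then show ?thesis
      using controlled_step[OF gap M _ wc nz] Cons.prems(1) by auto
  qed
qed

text \<open>Controlled circles meet the closed unit disc and have bounded discriminant and leading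
  coefficient, with bounds independent of the digits; so there are finitely many.\<close>

lemma frontier_range_sets_in_circles:
  obtains G where "finite G" "\<And>g. g \<in> G \<Longrightarrow> 0 < circ_disc g"
    "\<And>bs. set bs \<subseteq> gaussian_integers \<Longrightarrow> frontier (range_set \<alpha> bs) \<subseteq> (\<Union>g\<in>G. circ_zeros g)"
proof -
  obtain \<delta> where \<delta>: "0 < \<delta>" and gap: "\<And>z w. z \<in> closed_domain \<alpha> \<Longrightarrow> w \<in> closed_domain \<alpha> \<Longrightarrow> z \<noteq> 0 \<Longrightarrow>
    1 / z - w \<in> gaussian_integers \<Longrightarrow> \<delta> \<le> (1 - (cmod w)\<^sup>2) + (1 - (cmod z)\<^sup>2)\<^sup>2"
    by (rule uniform_gap) blast
  \<comment> \<open>The least \<open>M\<close> for which \<open>M * \<delta>\<close> absorbs the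
    additive term \<open>q + s\<close> of one step.\<close>
  define M where "M = (real q + real s) / \<delta>"
  have M: "0 \<le> M" "real q + real s \<le> M * \<delta>" using \<delta> by (auto simp: M_def)
  define G where "G = {g. \<exists>w. controlled M g w}"
  define N where "N = 2 * M + (real q)\<^sup>2 + (real s)\<^sup>2"
  have "G \<subseteq> {g. circ_disc g \<le> N \<and> \<bar>circ_lead g\<bar> \<le> N \<and>
    (\<exists>z. cmod z \<le> 1 \<and> circ_eval g z = 0)}"
  proof
    fix g assume "g \<in> G"
    then obtain w where w: "controlled M g w" by (auto simp: G_def)
    have "M * (2 - (cmod w)\<^sup>2) \<le> M * 2" using M(1) by (intro mult_left_mono) auto
    then have "\<bar>circ_lead g\<bar> \<le> N"
      using w zero_le_power2[of "real q"] zero_le_power2[of "real s"]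
      unfolding controlled_def N_def by linarith
    moreover have "cmod w \<le> 1"
      using w closed_domain_norm_le(1)[of w] by (auto simp: controlled_def abs_square_le_1)
    ultimately show "g \<in> {g. circ_disc g \<le> N \<and> \<bar>circ_lead g\<bar> \<le> N \<and>
        (\<exists>z. cmod z \<le> 1 \<and> circ_eval g z = 0)}"
      using w M(1) by (auto simp: controlled_def N_def)
  qed
  then have "finite G" by (rule finite_subset) (rule finite_circlines_bounded)
  moreover have "0 < circ_disc g" if "g \<in> G" for g
    using that pos by (auto simp: G_def controlled_def)
  moreover have "frontier (range_set \<alpha> bs) \<subseteq> (\<Union>g\<in>G. circ_zeros g)"
    if bs: "set bs \<subseteq> gaussian_integers" for bs
  proof
    fix w assume "w \<in> frontier (range_set \<alpha> bs)"
    then obtain g where "controlled M g w"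
      using frontier_range_set_controlled[OF gap M bs] by blast
    then have "g \<in> G" "w \<in> circ_zeros g"
      by (auto simp only: G_def circ_zeros_def controlled_def mem_Collect_eq)
    then show "w \<in> (\<Union>g\<in>G. circ_zeros g)" by blast
  qed
  ultimately show ?thesis using that by blast
qed

end

section \<open>Finite range and finite partition\<close>

lemma ae_equalI:
  assumes "negligible N" "A - N \<subseteq> B" "B - N \<subseteq> A"
  shows "ae_equal A B"
proof -
  have "negligible ((A - B) \<union> (B - A))"
    using assms(1) by (rule negligible_subset) (use assms(2,3) in auto)
  then show ?thesis by (simp add: ae_equal_def negligible_iff_null_sets)
qed

lemma ae_equal_sym: "ae_equal A B \<Longrightarrow> ae_equal B A"
  by (simp add: ae_equal_def Un_commute)

lemma ae_equal_trans:
  assumes "ae_equal A B" "ae_equal B C"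
  shows "ae_equal A C"
proof (rule ae_equalI)
  show "negligible (((A - B) \<union> (B - A)) \<union> ((B - C) \<union> (C - B)))"
    using assms unfolding ae_equal_def negligible_iff_null_sets by (rule null_sets.Un)
qed auto

lemma ae_equal_Diff: "negligible N \<Longrightarrow> ae_equal A (A - N)"
  by (rule ae_equalI) auto

section \<open>Range sets modulo one common null set\<close>

context rational_domain
begin

definition gaussian_ranges :: "complex set set" where
  "gaussian_ranges = range_set \<alpha> ` {bs. set bs \<subseteq> gaussian_integers}"

text \<open>\<open>K\<close> is the union of the finitely many circles. A connected piece off
  \<open>K\<close> misses the frontier of a range set \<open>X\<close>, so it is contained in
  \<open>X\<close> or disjoint from it, and \<open>X - K\<close> is a union of pieces from a finite
  family. The pullback of \<open>K\<close> lies on transformed circles of the same discriminant,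
  hence is null.\<close>

lemma gaussian_ranges_finite_mod_null:
  obtains K where "closed K" "negligible K"
    "\<And>b. b \<in> gaussian_integers \<Longrightarrow> negligible {w. w + b \<noteq> 0 \<and> 1 / (w + b) \<in> K}"
    "\<And>X. X \<in> gaussian_ranges \<Longrightarrow> frontier X \<subseteq> K"
    "finite ((\<lambda>X. X - K) ` gaussian_ranges)"
proof -
  obtain G where G: "finite G" "\<And>g. g \<in> G \<Longrightarrow> 0 < circ_disc g"
    "\<And>bs. set bs \<subseteq> gaussian_integers \<Longrightarrow> frontier (range_set \<alpha> bs) \<subseteq> (\<Union>g\<in>G. circ_zeros g)"
    by (rule frontier_range_sets_in_circles) blast
  define K where "K = (\<Union>g\<in>G. circ_zeros g)"
  have fr: "frontier X \<subseteq> K" if "X \<in> gaussian_ranges" for X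
    using that G(3) by (auto simp: gaussian_ranges_def K_def)
  have "closed K" unfolding K_def using G(1) closed_circ_zeros by blast
  moreover have "negligible K"
    unfolding K_def using G(1,2) negligible_circ_zeros by (intro negligible_Union) auto
  moreover have "negligible {w. w + b \<noteq> 0 \<and> 1 / (w + b) \<in> K}" if b: "b \<in> gaussian_integers" for b
  proof -
    obtain m n where mn: "b = Complex (of_int m) (of_int n)"
      using b by (auto simp: gaussian_integers_def complex_eq_iff elim!: Ints_cases)
    have "{w. w + b \<noteq> 0 \<and> 1 / (w + b) \<in> K} \<subseteq> (\<Union>g\<in>G. circ_zeros (circ_step m n g))"
      using circ_eval_step[of _ m n] by (auto simp: K_def circ_zeros_def mn)
    moreover have "negligible (\<Union>g\<in>G. circ_zeros (circ_step m n g))"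
    proof (intro negligible_Union)
      fix T assume "T \<in> (\<lambda>g. circ_zeros (circ_step m n g)) ` G"
      then obtain g where "g \<in> G" "T = circ_zeros (circ_step m n g)" by blast
      then show "negligible T"
        using negligible_circ_zeros[of "circ_step m n g"] G(2)[of g] by (simp only: circ_disc_step)
    qed (use G(1) in simp)
    ultimately show ?thesis by (rule negligible_subset[rotated])
  qed
  moreover have "finite ((\<lambda>X. X - K) ` gaussian_ranges)"
  proof -
    have "closed_domain \<alpha> \<subseteq> cball 0 1"
      using closed_domain_norm_le(1) by (auto simp: abs_square_le_1)
    then have "compact (closed_domain \<alpha>)"
      using closed_closed_domain bounded_subset[OF bounded_cball] by (auto simp: compact_eq_bounded_closed)
    then obtain \<C> where \<C>: "finite \<C>" "\<And>C. C \<in> \<C> \<Longrightarrow> connected C" "\<And>C. C \<in> \<C> \<Longrightarrow> C \<inter> K = {}"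
      "closed_domain \<alpha> - K \<subseteq> \<Union>\<C>"
      unfolding K_def by (rule circline_cells_finite[OF G(1)]) blast
    have "X - K \<in> Union ` Pow \<C>" if X: "X \<in> gaussian_ranges" for X
    proof -
      have sub: "X \<subseteq> closed_domain \<alpha>"
        using X range_set_subset closure_fund_domain_subset closure_subset
        unfolding gaussian_ranges_def by blast
      have in_X: "C \<subseteq> X" if "C \<in> \<C>" "C \<inter> X \<noteq> {}" for C
        using connected_Int_frontier[of C X] that \<C>(2,3)[of C] fr[OF X] by auto
      have "X - K = \<Union>{C \<in> \<C>. C \<inter> X \<noteq> {}}"
      proof (intro equalityI subsetI)
        fix x assume "x \<in> X - K"
        then show "x \<in> \<Union>{C \<in> \<C>. C \<inter> X \<noteq> {}}" using sub \<C>(4) by blast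
      next
        fix x assume "x \<in> \<Union>{C \<in> \<C>. C \<inter> X \<noteq> {}}"
        then show "x \<in> X - K" using in_X \<C>(3) by blast
      qed
      then show ?thesis by (intro image_eqI) auto
    qed
    then have "(\<lambda>X. X - K) ` gaussian_ranges \<subseteq> Union ` Pow \<C>" by blast
    then show ?thesis by (rule finite_subset) (use \<C>(1) in simp)
  qed
  ultimately show ?thesis using fr that by blast
qed

lemma finite_range: "finite_range_condition \<alpha>"
proof -
  obtain K where K: "negligible K" "finite ((\<lambda>X. X - K) ` gaussian_ranges)"
    by (rule gaussian_ranges_finite_mod_null) blast
  define R where "R = {(A, B). ae_equal A B}"
  have eq: "R `` {X} = R `` {X - K}" for X
    using ae_equal_Diff[OF K(1), of X] ae_equal_sym ae_equal_trans unfolding R_def by blast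
  have "range_sets \<alpha> // R \<subseteq> (\<lambda>Y. R `` {Y}) ` (\<lambda>X. X - K) ` gaussian_ranges"
  proof
    fix Z assume "Z \<in> range_sets \<alpha> // R"
    then obtain bs where bs: "set bs \<subseteq> gaussian_integers"
      "Z = R `` {(hurwitz_map \<alpha> ^^ length bs) ` cylinder \<alpha> bs}"
      by (auto simp: quotient_def range_sets_def)
    then have "Z = R `` {range_set \<alpha> (rev bs) - K}"
      using eq hurwitz_map_funpow_image[OF bs(1)] by simp
    moreover have "range_set \<alpha> (rev bs) \<in> gaussian_ranges"
      unfolding gaussian_ranges_def using bs(1) by (intro imageI) simp
    ultimately show "Z \<in> (\<lambda>Y. R `` {Y}) ` (\<lambda>X. X - K) ` gaussian_ranges" by blast
  qed
  then show ?thesis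
    unfolding finite_range_condition_def R_def[symmetric] by (rule finite_subset) (use K(2) in simp)
qed

section \<open>The partition into atoms\<close>

text \<open>The partition consists of the atoms of the finite algebra generated by the range sets modulo
  null sets.\<close>

lemma finite_partition: "admits_finite_partition \<alpha>"
proof -
  obtain K where K: "closed K" "negligible K"
    "\<And>b. b \<in> gaussian_integers \<Longrightarrow> negligible {w. w + b \<noteq> 0 \<and> 1 / (w + b) \<in> K}"
    "\<And>X. X \<in> gaussian_ranges \<Longrightarrow> frontier X \<subseteq> K"
    "finite ((\<lambda>X. X - K) ` gaussian_ranges)"
    by (rule gaussian_ranges_finite_mod_null) blast
  define \<Y> where "\<Y> = (\<lambda>X. X - K) ` gaussian_ranges"
  have U: "fund_domain \<alpha> \<in> gaussian_ranges"
    unfolding gaussian_ranges_def by (rule image_eqI[of _ _ "[]"]) auto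
  have open_\<Y>: "open Y" if Y: "Y \<in> \<Y>" for Y
  proof -
    obtain X where X: "X \<in> gaussian_ranges" "Y = X - K" using Y by (auto simp: \<Y>_def)
    \<comment> \<open>The frontier of \<open>X\<close> lies in \<open>K\<close>, so removing
      \<open>K\<close> leaves an open set; this makes the atoms Borel.\<close>
    have "X - K = interior X - K"
      using K(4)[OF X(1)] closure_subset[of X] interior_subset[of X] by (auto simp: frontier_def)
    then show ?thesis using K(1) X(2) by auto
  qed
  define D where "D = fund_domain \<alpha> - K"
  define atom where "atom = (\<lambda>S. D - \<Union>(\<Y> - S) - (\<Union>Y\<in>S. - Y))"
  define \<P> where "\<P> = atom ` Pow \<Y>"
  \<comment> \<open>On \<open>D\<close> the atoms are the fibres of \<open>code\<close>.\<close>
  define code where "code = (\<lambda>w. {Y \<in> \<Y>. w \<in> Y})"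
  have atom_iff: "w \<in> atom S \<longleftrightarrow> w \<in> D \<and> code w = S" if "S \<subseteq> \<Y>" for w S
    using that by (auto simp: atom_def code_def)
  have "finite \<P>" using K(5) by (simp add: \<P>_def \<Y>_def)
  moreover have "is_partition \<alpha> \<P>"
    unfolding is_partition_def
  proof (intro conjI ballI)
    fix P assume "P \<in> \<P>"
    then obtain S where S: "S \<subseteq> \<Y>" "P = atom S" by (auto simp: \<P>_def)
    have "finite S" using S(1) K(5) finite_subset unfolding \<Y>_def by blast
    have "D \<in> \<Y>" unfolding \<Y>_def D_def by (rule imageI[OF U])
    then have "D \<in> sets borel" using open_\<Y> by (intro borel_open)
    moreover have "\<Union>(\<Y> - S) \<in> sets borel" using open_\<Y> by (intro borel_open open_Union) simp
    moreover have "(\<Union>Y\<in>S. - Y) \<in> sets borel"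
      using open_\<Y> S(1) \<open>finite S\<close> by (intro borel_closed closed_UN) (auto simp: closed_Compl)
    ultimately show "P \<in> sets borel" unfolding S(2) atom_def by auto
    show "P \<subseteq> fund_domain \<alpha>" unfolding S(2) atom_def D_def by auto
  next
    show "pairwise disjnt \<P>"
      unfolding pairwise_def disjnt_def \<P>_def using atom_iff by auto
    have "\<Union>\<P> = D"
    proof
      show "\<Union>\<P> \<subseteq> D" unfolding \<P>_def atom_def by auto
      show "D \<subseteq> \<Union>\<P>"
      proof
        fix w assume "w \<in> D"
        moreover have "code w \<subseteq> \<Y>" by (auto simp: code_def)
        ultimately have "w \<in> atom (code w)" "atom (code w) \<in> \<P>"
          using atom_iff by (auto simp: \<P>_def)
        then show "w \<in> \<Union>\<P>" by blast
      qed
    qed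
    then show "ae_equal (fund_domain \<alpha>) (\<Union>\<P>)"
      using ae_equal_Diff[OF K(2)] by (simp add: D_def)
  qed
  moreover have "\<exists>\<Q>\<subseteq>\<P>. ae_equal (hurwitz_map \<alpha> ` (cylinder1 \<alpha> b \<inter> P)) (\<Union>\<Q>)"
    if b: "b \<in> gaussian_integers" and P: "P \<in> \<P>" for b P
  proof -
    \<comment> \<open>Off \<open>N\<close>, neither \<open>w\<close> nor, if
      \<open>w + b \<noteq> 0\<close>, the point \<open>1 / (w + b)\<close> lies in
      \<open>K\<close>, so membership in \<open>X\<close> and in \<open>X - K\<close> agree at
      both.\<close>
    define N where "N = K \<union> {w. w + b \<noteq> 0 \<and> 1 / (w + b) \<in> K}"
    have N: "negligible N" unfolding N_def using K(2,3) b by (intro negligible_Un) auto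
    obtain S where S: "S \<subseteq> \<Y>" "P = atom S" using P by (auto simp: \<P>_def)
    define E where "E = {w \<in> fund_domain \<alpha>. w + b \<noteq> 0 \<and> 1 / (w + b) \<in> P}"
    have E: "hurwitz_map \<alpha> ` (cylinder1 \<alpha> b \<inter> P) = E"
      unfolding E_def using hurwitz_map_image[OF b, of P \<alpha>] S(2) by (auto simp: atom_def D_def)
    \<comment> \<open>The code of \<open>w\<close> records membership in
      \<open>range_set \<alpha> (b # bs)\<close> for all \<open>bs\<close>, that is, whether
      \<open>1 / (w + b)\<close> lies in \<open>range_set \<alpha> bs\<close>. So it determines the
      code of \<open>1 / (w + b)\<close>, and off \<open>N\<close> the set \<open>E\<close> is a
      union of atoms.\<close>
    have transfer: "v \<in> E" if w: "w \<in> E" "w \<notin> N" and v: "v \<in> D" "v \<notin> N" and wv: "code w = code v" for v w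
    proof -
      have mem: "w \<in> X \<longleftrightarrow> v \<in> X" if "X \<in> gaussian_ranges" for X
      proof -
        have "X - K \<in> code w \<longleftrightarrow> X - K \<in> code v" using wv by simp
        moreover have "X - K \<in> \<Y>" using that by (auto simp: \<Y>_def)
        ultimately show ?thesis using w(2) v(2) by (auto simp: code_def N_def)
      qed
      have pull: "w \<in> fund_domain \<alpha> \<and> w + b \<noteq> 0 \<and> 1 / (w + b) \<in> X \<longleftrightarrow>
          v \<in> fund_domain \<alpha> \<and> v + b \<noteq> 0 \<and> 1 / (v + b) \<in> X" if X: "X \<in> gaussian_ranges" for X
      proof -
        obtain bs where bs: "set bs \<subseteq> gaussian_integers" "X = range_set \<alpha> bs"
          using X by (auto simp: gaussian_ranges_def)
        then have "range_set \<alpha> (b # bs) \<in> gaussian_ranges"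
          unfolding gaussian_ranges_def using b by (intro imageI) simp
        from mem[OF this] show ?thesis by (simp add: bs(2))
      qed
      have w': "w \<in> fund_domain \<alpha>" "w + b \<noteq> 0" "1 / (w + b) \<in> D" "code (1 / (w + b)) = S"
        using w(1) atom_iff[OF S(1)] unfolding E_def S(2) by auto
      then have v': "v + b \<noteq> 0" "1 / (v + b) \<in> fund_domain \<alpha>"
        using pull[OF U] by (auto simp: D_def)
      then have nK: "1 / (v + b) \<notin> K" "1 / (w + b) \<notin> K"
        using w v w' by (auto simp: N_def)
      have "1 / (w + b) \<in> X - K \<longleftrightarrow> 1 / (v + b) \<in> X - K" if "X \<in> gaussian_ranges" for X
        using pull[OF that] w' v' v(1) nK by (auto simp: D_def)
      then have "code (1 / (v + b)) = S" using w'(4) by (auto simp: code_def \<Y>_def)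
      then show ?thesis
        using v(1) v' nK atom_iff[OF S(1)] by (simp add: E_def S(2) D_def)
    qed
    define \<Q> where "\<Q> = {atom (code w) |w. w \<in> D \<inter> E - N}"
    have code_sub: "code w \<subseteq> \<Y>" for w by (auto simp: code_def)
    have "\<Q> \<subseteq> \<P>" using code_sub by (auto simp: \<Q>_def \<P>_def)
    moreover have "ae_equal E (\<Union>\<Q>)"
    proof (rule ae_equalI[OF N])
      show "E - N \<subseteq> \<Union>\<Q>"
      proof
        fix w assume "w \<in> E - N"
        then have w: "w \<in> D \<inter> E - N" by (auto simp: D_def E_def N_def)
        then have "w \<in> atom (code w)" using atom_iff[OF code_sub] by simp
        then show "w \<in> \<Union>\<Q>" using w by (auto simp: \<Q>_def)
      qed
      show "\<Union>\<Q> - N \<subseteq> E"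
      proof
        fix v assume v: "v \<in> \<Union>\<Q> - N"
        then obtain w where "w \<in> D \<inter> E - N" "v \<in> atom (code w)" by (auto simp: \<Q>_def)
        then show "v \<in> E" using transfer[of w v] v atom_iff[OF code_sub] by auto
      qed
    qed
    ultimately show ?thesis using E by metis
  qed
  ultimately show ?thesis unfolding admits_finite_partition_def by blast
qed

end

theorem theorem3p1:
  fixes p q r s :: nat and \<alpha> :: "real \<times> real"
  assumes "0 < p" "0 < q" "0 < r" "0 < s"
    and "\<alpha> = (real p / real q, real r / real s)"
    and "\<alpha> \<in> admissible_region"
  shows "finite_range_condition \<alpha> \<and> admits_finite_partition \<alpha>"
proof -
  interpret rational_domain \<alpha> p q r s by unfold_locales (fact assms)+
  show ?thesis using finite_range finite_partition ..
qed

end
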